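(* Let $k\ge1$ be an integer and $0<\epsilon\le k$. There is a randomized online algorithm (E-RandBacktrack) for the $k$-Canadian Traveller Problem with predictions on path-disjoint graphs, knowing $k$, that is $\left[1+\epsilon,\,k+\frac{4k}{\epsilon}\right]$-competitive: on every instance whose prediction is correct, $\mathbb{E}[ALG]\le(1+\epsilon)OPT$, and on every instance whose prediction is not correct, $\mathbb{E}[ALG]\le\left(k+\frac{4k}{\epsilon}\right)OPT$.
   Context: $k$-Canadian Traveller Problem ($k$-CTP) with predictions: an instance consists of a connected undirected graph $G=(V,E)$, a source $s$, a destination $t$, a nonnegative cost function $c:E\to\mathbb{R}^+$, an unknown set $B\subseteq E$ of blocked edges with $|B|\le k$ such that $G-B$ contains an $s$-$t$ path, and a predicted set $B_p\subseteq E$ of blocked edges with $|B_p|\le k$. The traveller knows $G,c,s,t,k,B_p$ in advance, starts at $s$, and learns whether an edge is blocked only upon reaching one of its endpoints; blocked edges cannot be traversed. $ALG$ is the (random) total cost travelled, with instances fixed in advance (oblivious adversary); $OPT$ is the cost of a shortest $s$-$t$ path in $G-B$. The prediction is correct iff $B=B_p$. A graph is path-disjoint if all its $s$-$t$ paths are pairwise node-disjoint apart from $s$ and $t$. *)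

theory Defs
  imports "HOL-Probability.Probability"
begin

text \<open>
  Graphs are finite, simple and undirected; an edge is a two-element set of vertices.
  A path is given by its list of pairwise distinct vertices.
\<close>

definition is_walk :: "'v set set \<Rightarrow> 'v list \<Rightarrow> bool" where
  "is_walk E p \<longleftrightarrow> p \<noteq> [] \<and> successively (\<lambda>u v. {u, v} \<in> E) p"

definition is_path :: "'v set set \<Rightarrow> 'v \<Rightarrow> 'v \<Rightarrow> 'v list \<Rightarrow> bool" where
  "is_path E u v p \<longleftrightarrow> is_walk E p \<and> distinct p \<and> hd p = u \<and> last p = v"

definition walk_cost :: "('v set \<Rightarrow> real) \<Rightarrow> 'v list \<Rightarrow> real" where
  "walk_cost c p = sum_list (map2 (\<lambda>u v. c {u, v}) p (tl p))"

text \<open>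
  Everything the traveller knows in advance. The set of edges that are really blocked is
  deliberately not a component: it is the separate argument \<open>B\<close> below.
\<close>

record 'v ctp_input =
  verts     :: "'v set"
  edges     :: "'v set set"
  source    :: 'v
  target    :: 'v
  cost      :: "'v set \<Rightarrow> real"
  budget    :: nat
  predicted :: "'v set set"

definition ctp_input :: "'v ctp_input \<Rightarrow> bool" where
  "ctp_input I \<longleftrightarrow>
     finite (verts I) \<and>
     (\<forall>e\<in>edges I. e \<subseteq> verts I \<and> card e = 2) \<and>
     (\<forall>u\<in>verts I. \<forall>v\<in>verts I. \<exists>p. is_path (edges I) u v p) \<and>
     source I \<in> verts I \<and> target I \<in> verts I \<and>
     (\<forall>e\<in>edges I. 0 \<le> cost I e) \<and>
     predicted I \<subseteq> edges I \<and> card (predicted I) \<le> budget I"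

definition blockage :: "'v ctp_input \<Rightarrow> 'v set set \<Rightarrow> bool" where
  "blockage I B \<longleftrightarrow>
     B \<subseteq> edges I \<and> card B \<le> budget I \<and>
     (\<exists>p. is_path (edges I - B) (source I) (target I) p)"

definition path_disjoint :: "'v ctp_input \<Rightarrow> bool" where
  "path_disjoint I \<longleftrightarrow>
     (\<forall>p q. is_path (edges I) (source I) (target I) p \<longrightarrow>
            is_path (edges I) (source I) (target I) q \<longrightarrow> p \<noteq> q \<longrightarrow>
            set p \<inter> set q \<subseteq> {source I, target I})"

definition opt :: "'v ctp_input \<Rightarrow> 'v set set \<Rightarrow> real" where
  "opt I B = Min (walk_cost (cost I) ` {p. is_path (edges I - B) (source I) (target I) p})"

text \<open>
  A deterministic strategy chooses the next vertex from the walk made so far and the set of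
  blocked edges having an endpoint on that walk. Together with the input this determines the
  status of every edge at a visited vertex, at the present and at every earlier moment.
\<close>

type_synonym 'v strategy = "'v list \<Rightarrow> 'v set set \<Rightarrow> 'v"

definition revealed :: "'v set set \<Rightarrow> 'v list \<Rightarrow> 'v set set" where
  "revealed B w = {e \<in> B. e \<inter> set w \<noteq> {}}"

primrec run :: "'v ctp_input \<Rightarrow> 'v set set \<Rightarrow> 'v strategy \<Rightarrow> nat \<Rightarrow> 'v list" where
  "run I B \<sigma> 0 = [source I]"
| "run I B \<sigma> (Suc n) = run I B \<sigma> n @ [\<sigma> (run I B \<sigma> n) (revealed B (run I B \<sigma> n))]"

definition arrived :: "'v ctp_input \<Rightarrow> 'v set set \<Rightarrow> 'v strategy \<Rightarrow> nat \<Rightarrow> bool" where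
  "arrived I B \<sigma> n \<longleftrightarrow>
     is_walk (edges I - B) (run I B \<sigma> n) \<and> last (run I B \<sigma> n) = target I"

text \<open>
  The journey ends at the first arrival at the target. A strategy that makes an illegal move
  (along a non-edge or a blocked edge) before that, or that never arrives, has infinite cost.
\<close>

definition travel_cost :: "'v ctp_input \<Rightarrow> 'v set set \<Rightarrow> 'v strategy \<Rightarrow> ennreal" where
  "travel_cost I B \<sigma> =
     (if \<exists>n. arrived I B \<sigma> n
      then ennreal (walk_cost (cost I) (run I B \<sigma> (LEAST n. arrived I B \<sigma> n)))
      else \<infinity>)"

text \<open>
  A randomized online algorithm draws a deterministic strategy at random, depending only on
  the information known in advance; the adversary is oblivious, as \<open>B\<close> is fixed before
  the draw.
\<close>

type_synonym 'v online_algorithm = "'v ctp_input \<Rightarrow> 'v strategy pmf"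

definition expected_cost :: "'v online_algorithm \<Rightarrow> 'v ctp_input \<Rightarrow> 'v set set \<Rightarrow> ennreal" where
  "expected_cost A I B = (\<integral>\<^sup>+ \<sigma>. travel_cost I B \<sigma> \<partial>measure_pmf (A I))"

definition competitive_on ::
  "('v ctp_input \<Rightarrow> bool) \<Rightarrow> nat \<Rightarrow> 'v online_algorithm \<Rightarrow> real \<Rightarrow> real \<Rightarrow> bool" where
  "competitive_on \<G> k A \<alpha> \<beta> \<longleftrightarrow>
     (\<forall>I B. ctp_input I \<longrightarrow> budget I = k \<longrightarrow> \<G> I \<longrightarrow> blockage I B \<longrightarrow>
        (B = predicted I \<longrightarrow> expected_cost A I B \<le> ennreal (\<alpha> * opt I B)) \<and>
        (B \<noteq> predicted I \<longrightarrow> expected_cost A I B \<le> ennreal (\<beta> * opt I B)))"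

end

theory Submission
  imports Defs
begin

text \<open>
  Path-disjointness bounds the number of blocked paths by \<open>k\<close>, so the \<open>k + 1\<close> cheapest paths always
  contain an optimal one. They are explored in a random order, returning to the source at each
  blockage. If \<open>j\<close> is an optimal path and \<open>d i\<close> the cost of path \<open>i\<close>, the journey costs at most
  \<open>d j\<close> plus \<open>2 * d i\<close> for each \<open>i\<close> placed before \<open>j\<close>.

  Drawing paths without replacement with odds \<open>1 / (e i)\<^sup>2\<close> puts \<open>i\<close> before \<open>j\<close> with probability
  \<open>(e j)\<^sup>2 / ((e i)\<^sup>2 + (e j)\<^sup>2)\<close>, which is at most \<open>e j / (2 * e i)\<close>. With \<open>e = d\<close> each of the other
  \<open>k\<close> paths thus contributes at most \<open>d j\<close>. Replacing \<open>e\<close> by \<open>\<epsilon> / (2 * k) * d\<close> on the single path that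
  the prediction declares optimal reduces the total contribution to \<open>\<epsilon> / 2 * d j\<close> when \<open>j\<close> is that
  path, and raises only its own contribution, to \<open>2 * k / \<epsilon> * d j\<close>, when it is not.
\<close>

section \<open>Random orders with prescribed pairwise odds\<close>

text \<open>If all \<open>e x\<close> are positive, the weights \<open>1 / (e x)\<^sup>2\<close> can
  be normalised. If some \<open>e x\<close> vanishes, a point mass there makes both products
  zero.\<close>

lemma ex_pmf_inverse_square:
  fixes e :: "'a \<Rightarrow> real"
  assumes S: "finite S" "S \<noteq> {}" and e: "\<And>x. x \<in> S \<Longrightarrow> 0 \<le> e x"
  shows "\<exists>f. set_pmf f \<subseteq> S \<and> (\<forall>i\<in>S. \<forall>j\<in>S. pmf f i * (e i)\<^sup>2 = pmf f j * (e j)\<^sup>2)"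
proof (cases "\<exists>x\<in>S. e x = 0")
  case True
  then obtain x where x: "x \<in> S" "e x = 0" by blast
  have "pmf (return_pmf x) i * (e i)\<^sup>2 = 0" for i
    using x by (auto simp: indicator_def)
  note this [simp]
  show ?thesis using x by (intro exI[of _ "return_pmf x"]) (simp del: pmf_return)
next
  case False
  then have pos: "0 < e x" if "x \<in> S" for x using e[OF that] that by force
  define W where "W = (\<Sum>x\<in>S. 1 / (e x)\<^sup>2)"
  define g where "g = (\<lambda>x. if x \<in> S then 1 / (e x)\<^sup>2 / W else 0)"
  have W: "0 < W" unfolding W_def using S by (intro sum_pos) (auto dest: pos)
  have g: "0 \<le> g x" for x using W by (auto simp: g_def)
  have sum_g: "(\<Sum>x\<in>S. g x) = 1"
  proof -
    have "(\<Sum>x\<in>S. g x) = (\<Sum>x\<in>S. 1 / (e x)\<^sup>2) / W"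
      by (simp add: g_def sum_divide_distrib)
    then show ?thesis using W by (simp flip: W_def)
  qed
  have supp: "{x. g x \<noteq> 0} \<subseteq> S" by (auto simp: g_def)
  have total: "(\<integral>\<^sup>+x. ennreal (g x) \<partial>count_space UNIV) = 1"
    using sum_g g supp S(1)
    by (subst nn_integral_count_space'[of S]) (auto simp: sum_ennreal)
  have pmf: "pmf (embed_pmf g) x = g x" for x using g total by (rule pmf_embed_pmf)
  have "pmf (embed_pmf g) i * (e i)\<^sup>2 = 1 / W" if "i \<in> S" for i
    unfolding pmf using pos[OF that] that by (simp add: g_def)
  then show ?thesis
    using supp by (intro exI[of _ "embed_pmf g"]) (auto simp: set_pmf_iff pmf)
qed

text \<open>
  Drawing without replacement, each time with odds proportional to \<open>1 / (e x)\<^sup>2\<close>; elements with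
  \<open>e x = 0\<close> come first. The identity is multiplied out to cover them.
\<close>

lemma ex_random_order:
  fixes e :: "'a \<Rightarrow> real"
  assumes "finite S" and "\<forall>x\<in>S. 0 \<le> e x"
  shows "\<exists>Q. (\<forall>\<pi>\<in>set_pmf Q. distinct \<pi> \<and> set \<pi> = S) \<and>
    (\<forall>i\<in>S. \<forall>j\<in>S. i \<noteq> j \<longrightarrow>
       measure_pmf.prob Q {\<pi>. i \<in> set (takeWhile (\<lambda>x. x \<noteq> j) \<pi>)} * ((e i)\<^sup>2 + (e j)\<^sup>2) = (e j)\<^sup>2)"
  using assms
proof (induction S rule: finite_psubset_induct)
  case (psubset S)
  show ?case
  proof (cases "S = {}")
    case True
    then show ?thesis by (intro exI[of _ "return_pmf []"]) auto
  next
    case False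
    define before :: "'a \<Rightarrow> 'a \<Rightarrow> 'a list set"
      where "before i j = {\<pi>. i \<in> set (takeWhile (\<lambda>x. x \<noteq> j) \<pi>)}" for i j
    obtain f where f: "set_pmf f \<subseteq> S"
      "\<And>i j. i \<in> S \<Longrightarrow> j \<in> S \<Longrightarrow> pmf f i * (e i)\<^sup>2 = pmf f j * (e j)\<^sup>2"
      using ex_pmf_inverse_square[of S e] psubset.hyps psubset.prems False by blast
    have "\<forall>x\<in>S. \<exists>Q. (\<forall>\<pi>\<in>set_pmf Q. distinct \<pi> \<and> set \<pi> = S - {x}) \<and>
        (\<forall>i\<in>S - {x}. \<forall>j\<in>S - {x}. i \<noteq> j \<longrightarrow>
           measure_pmf.prob Q (before i j) * ((e i)\<^sup>2 + (e j)\<^sup>2) = (e j)\<^sup>2)"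
      unfolding before_def using psubset.prems by (intro ballI psubset.IH) auto
    from bchoice[OF this] obtain G where G:
      "\<And>x \<pi>. x \<in> S \<Longrightarrow> \<pi> \<in> set_pmf (G x) \<Longrightarrow> distinct \<pi> \<and> set \<pi> = S - {x}"
      "\<And>x i j. x \<in> S \<Longrightarrow> i \<in> S - {x} \<Longrightarrow> j \<in> S - {x} \<Longrightarrow> i \<noteq> j \<Longrightarrow>
         measure_pmf.prob (G x) (before i j) * ((e i)\<^sup>2 + (e j)\<^sup>2) = (e j)\<^sup>2"
      by metis
    define H where "H x = map_pmf (Cons x) (G x)" for x
    define Q where "Q = bind_pmf f H"
    have "distinct \<pi> \<and> set \<pi> = S" if "\<pi> \<in> set_pmf Q" for \<pi>
      using that f(1) G(1) by (fastforce simp: Q_def H_def)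
    moreover have "measure_pmf.prob Q (before i j) * ((e i)\<^sup>2 + (e j)\<^sup>2) = (e j)\<^sup>2"
      if ij: "i \<in> S" "j \<in> S" "i \<noteq> j" for i j
    proof -
      \<comment> \<open>Conditioning on the first draw \<open>x\<close>: drawing \<open>i\<close> or
        \<open>j\<close> settles their relative order, and any other draw leaves it to the order of
        the remaining elements.\<close>
      have prob_H: "measure_pmf.prob (H x) (before i j) =
          (if x = i then 1 else if x = j then 0 else measure_pmf.prob (G x) (before i j))" for x
      proof -
        have "Cons x -` before i j = (if x = i then UNIV else if x = j then {} else before i j)"
          using ij by (auto simp: before_def)
        then show ?thesis by (simp add: H_def)
      qed
      have "measure_pmf.prob Q (before i j) = (\<integral>x. measure_pmf.prob (H x) (before i j) \<partial>f)"
        unfolding Q_def measure_pmf_bind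
        by (rule measure_pmf.measure_bind[where N = "count_space UNIV"])
          (auto simp: measure_pmf_in_subprob_algebra)
      also have "\<dots> = (\<Sum>x\<in>S. pmf f x * measure_pmf.prob (H x) (before i j))"
        using psubset.hyps f(1) by (subst integral_measure_pmf_real[of S]) (auto simp: mult.commute)
      also have "S = insert i (insert j (S - {i, j}))" using ij by blast
      also have "(\<Sum>x\<in>\<dots>. pmf f x * measure_pmf.prob (H x) (before i j)) =
          pmf f i + (\<Sum>x\<in>S - {i, j}. pmf f x * measure_pmf.prob (G x) (before i j))"
        using ij psubset.hyps by (auto simp: prob_H intro!: sum.cong)
      finally have "measure_pmf.prob Q (before i j) * ((e i)\<^sup>2 + (e j)\<^sup>2) =
          pmf f i * ((e i)\<^sup>2 + (e j)\<^sup>2) + (\<Sum>x\<in>S - {i, j}. pmf f x *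
            (measure_pmf.prob (G x) (before i j) * ((e i)\<^sup>2 + (e j)\<^sup>2)))"
        by (simp add: distrib_right sum_distrib_right mult.assoc)
      also have "\<dots> = pmf f i * ((e i)\<^sup>2 + (e j)\<^sup>2) + (\<Sum>x\<in>S - {i, j}. pmf f x) * (e j)\<^sup>2"
        unfolding sum_distrib_right
        using ij by (intro arg_cong2[of _ _ _ _ "(+)"] refl sum.cong) (subst G(2); blast)
      \<comment> \<open>The balance property of \<open>f\<close> replaces
        \<open>pmf f i * (e i)\<^sup>2\<close> by \<open>pmf f j * (e j)\<^sup>2\<close>, so every
        possible first draw ends up carrying the common factor \<open>(e j)\<^sup>2\<close> and the
        masses add up to 1.\<close>
      also have "\<dots> = (pmf f i + pmf f j + (\<Sum>x\<in>S - {i, j}. pmf f x)) * (e j)\<^sup>2"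
        using f(2)[OF ij(1,2)] by (simp add: algebra_simps)
      also have "pmf f i + pmf f j + (\<Sum>x\<in>S - {i, j}. pmf f x) = (\<Sum>x\<in>S. pmf f x)"
        using ij psubset.hyps by (simp add: sum_diff)
      also have "\<dots> = 1" using psubset.hyps f(1) by (rule sum_pmf_eq_1)
      finally show ?thesis by simp
    qed
    ultimately show ?thesis unfolding before_def by blast
  qed
qed

text \<open>AM-GM is the reason for inverse squares: \<open>2 * a * b\<close> is at most
  \<open>a\<^sup>2 + b\<^sup>2\<close>, so the doubled weight \<open>2 * e i\<close>, discounted by
  the probability that \<open>i\<close> precedes \<open>j\<close>, can be charged to
  \<open>e j\<close>.\<close>

lemma ex_balanced_random_order:
  fixes e :: "'a \<Rightarrow> real"
  assumes "finite S" and e: "\<forall>x\<in>S. 0 \<le> e x"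
  shows "\<exists>Q. (\<forall>\<pi>\<in>set_pmf Q. distinct \<pi> \<and> set \<pi> = S) \<and>
    (\<forall>i\<in>S. \<forall>j\<in>S. i \<noteq> j \<longrightarrow>
       2 * e i * measure_pmf.prob Q {\<pi>. i \<in> set (takeWhile (\<lambda>x. x \<noteq> j) \<pi>)} \<le> e j)"
proof -
  have *: "2 * a * P \<le> b" if "0 \<le> a" "0 \<le> b" "0 \<le> P" "P * (a\<^sup>2 + b\<^sup>2) = b\<^sup>2" for a b P :: real
  proof (cases "b = 0")
    case True
    then show ?thesis using that by auto
  next
    case False
    have "0 \<le> P * (a - b)\<^sup>2" using that by simp
    then have "2 * a * P * b \<le> b * b"
      using that(4) by (simp add: power2_eq_square algebra_simps)
    then show ?thesis using False that(2) by simp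
  qed
  obtain Q where Q: "\<forall>\<pi>\<in>set_pmf Q. distinct \<pi> \<and> set \<pi> = S"
    "\<forall>i\<in>S. \<forall>j\<in>S. i \<noteq> j \<longrightarrow>
      measure_pmf.prob Q {\<pi>. i \<in> set (takeWhile (\<lambda>x. x \<noteq> j) \<pi>)} * ((e i)\<^sup>2 + (e j)\<^sup>2) = (e j)\<^sup>2"
    using ex_random_order[OF assms] by (elim exE conjE) (rule that)
  show ?thesis using Q by (intro exI[of _ Q] conjI ballI impI *) (auto simp: e)
qed

section \<open>Exploring paths one after another\<close>

lemma walk_cost_simps [simp]:
  "walk_cost c [x] = 0"
  "walk_cost c (x # y # zs) = c {x, y} + walk_cost c (y # zs)"
  by (simp_all add: walk_cost_def)

lemma walk_cost_append_tl:
  "xs \<noteq> [] \<Longrightarrow> ys \<noteq> [] \<Longrightarrow> last xs = hd ys \<Longrightarrow>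
   walk_cost c (xs @ tl ys) = walk_cost c xs + walk_cost c ys"
proof (induction xs rule: induct_list012)
  case (2 x)
  then show ?case by (cases ys) auto
qed auto

lemma walk_cost_rev: "walk_cost c (rev xs) = walk_cost c xs"
proof (induction xs rule: induct_list012)
  case (3 x y zs)
  then show ?case
    using walk_cost_append_tl[of "rev (y # zs)" "[y, x]" c] by (simp add: insert_commute)
qed auto

lemma walk_cost_nonneg:
  assumes "is_walk E p" and "\<And>e. e \<in> E \<Longrightarrow> 0 \<le> c e"
  shows "0 \<le> walk_cost c p"
  using assms
proof (induction p rule: induct_list012)
  case (3 x y zs)
  then show ?case by (auto simp: is_walk_def)
qed (auto simp: is_walk_def walk_cost_def)

lemma is_walk_append_tl:
  assumes "is_walk E xs" "is_walk E ys" "last xs = hd ys"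
  shows "is_walk E (xs @ tl ys)"
  using assms by (cases ys; cases "tl ys") (auto simp: is_walk_def successively_append_iff)

lemma is_walk_rev: "is_walk E (rev p) = is_walk E p"
  by (simp add: is_walk_def insert_commute)

text \<open>\<open>travel_cost\<close> stops at the first arrival; this bounds its value by the cost
  of a complete itinerary without locating that arrival.\<close>

lemma walk_cost_take_le:
  assumes "is_walk E p" and "\<And>e. e \<in> E \<Longrightarrow> 0 \<le> c e"
  shows "walk_cost c (take n p) \<le> walk_cost c p"
  using assms
proof (induction p arbitrary: n rule: induct_list012)
  case (2 x)
  then show ?case by (cases n) (auto simp: walk_cost_def)
next
  case (3 x y zs)
  have nonneg: "0 \<le> c {x, y}" "0 \<le> walk_cost c (y # zs)"
    using 3(3,4) walk_cost_nonneg[of E "y # zs" c] by (auto simp: is_walk_def)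
  have IH: "walk_cost c (take m (y # zs)) \<le> walk_cost c (y # zs)" for m
    using 3 by (auto simp: is_walk_def)
  consider "n = 0" | "n = 1" | m where "n = Suc (Suc m)"
    by (metis One_nat_def not0_implies_Suc)
  then show ?case
    using nonneg IH[of "Suc _"] by cases (auto simp: walk_cost_def)
qed auto

section \<open>The initial segment of a path up to its first blocked edge\<close>

fun free_prefix :: "'v set set \<Rightarrow> 'v list \<Rightarrow> 'v list" where
  "free_prefix B (u # v # p) = (if {u, v} \<in> B then [u] else u # free_prefix B (v # p))"
| "free_prefix B p = p"

lemma free_prefix_eq_Nil_iff [simp]: "free_prefix B p = [] \<longleftrightarrow> p = []"
  by (cases "(B, p)" rule: free_prefix.cases) auto

lemma hd_free_prefix [simp]: "hd (free_prefix B p) = hd p"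
  by (cases "(B, p)" rule: free_prefix.cases) auto

lemma free_prefix_eq_iff:
  "free_prefix B p = p \<longleftrightarrow> successively (\<lambda>u v. {u, v} \<notin> B) p"
  by (induction B p rule: free_prefix.induct) auto

lemma is_walk_free_prefix: "is_walk E p \<Longrightarrow> is_walk (E - B) (free_prefix B p)"
proof (induction B p rule: free_prefix.induct)
  case (1 B u v p)
  then show ?case by (cases p) (auto simp: is_walk_def)
qed (auto simp: is_walk_def)

text \<open>Justifies \<open>free_prefix B p = p\<close> as the test for an unblocked path in all
  that follows.\<close>

lemma is_path_diff_iff:
  "is_path (E - B) s t p \<longleftrightarrow> is_path E s t p \<and> free_prefix B p = p"
proof -
  have "successively (\<lambda>u v. {u, v} \<in> E - B) p \<longleftrightarrow>
      successively (\<lambda>u v. {u, v} \<in> E) p \<and> successively (\<lambda>u v. {u, v} \<notin> B) p"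
    by (induction p rule: induct_list012) auto
  then show ?thesis by (auto simp: is_path_def is_walk_def free_prefix_eq_iff)
qed

lemma walk_cost_free_prefix_le:
  assumes "is_walk E p" and "\<And>e. e \<in> E \<Longrightarrow> 0 \<le> c e"
  shows "walk_cost c (free_prefix B p) \<le> walk_cost c p"
  using assms
proof (induction B p rule: free_prefix.induct)
  case (1 B u v p)
  then have "0 \<le> walk_cost c (u # v # p)" by (intro walk_cost_nonneg)
  moreover have "walk_cost c (u # free_prefix B (v # p)) =
      c {u, v} + walk_cost c (free_prefix B (v # p))"
    using walk_cost_append_tl[of "[u, v]" "free_prefix B (v # p)" c]
    by (cases "free_prefix B (v # p)") (auto dest: arg_cong[of _ _ hd])
  ultimately show ?case using 1 by (auto simp: is_walk_def)
qed auto

text \<open>Knowing fewer blocked edges can only lengthen the prefix, so moves planned from partial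
  knowledge are correct for as long as the true prefix lasts.\<close>

lemma nth_free_prefix_mono:
  assumes "R \<subseteq> B" "n < length (free_prefix B p)"
  shows "n < length (free_prefix R p) \<and> free_prefix R p ! n = free_prefix B p ! n"
  using assms
proof (induction B p arbitrary: n rule: free_prefix.induct)
  case (1 B u v p)
  then show ?case by (cases n) (auto split: if_splits)
qed auto

text \<open>The first blocked edge of \<open>p\<close> has its near endpoint on the true prefix.
  Once that prefix has been visited, this edge lies in \<open>R\<close> and stops both prefixes at
  the same vertex.\<close>

lemma free_prefix_revealed:
  assumes "R \<subseteq> B" "\<And>e. e \<in> B \<Longrightarrow> e \<inter> set (free_prefix B p) \<noteq> {} \<Longrightarrow> e \<in> R"
  shows "free_prefix R p = free_prefix B p"
  using assms
proof (induction B p rule: free_prefix.induct)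
  case (1 B u v p)
  then show ?case by (cases "{u, v} \<in> B") auto
qed auto

text \<open>
  The vertices visited after the source when the paths are tried in the given order,
  with return to the source at each blocked edge.
\<close>

primrec itinerary :: "'v set set \<Rightarrow> 'v list list \<Rightarrow> 'v list" where
  "itinerary B [] = []"
| "itinerary B (p # ps) =
    (if free_prefix B p = p then tl p
     else tl (free_prefix B p) @ tl (rev (free_prefix B p)) @ itinerary B ps)"

text \<open>This makes following the itinerary an online strategy.\<close>

lemma itinerary_revealed:
  assumes "\<And>p. p \<in> set ps \<Longrightarrow> p \<noteq> [] \<and> hd p = s" and "R \<subseteq> B"
    and "\<And>e. e \<in> B \<Longrightarrow> e \<inter> set (s # take n (itinerary B ps)) \<noteq> {} \<Longrightarrow> e \<in> R"
    and "n < length (itinerary B ps)"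
  shows "itinerary R ps ! n = itinerary B ps ! n"
  using assms
proof (induction ps arbitrary: n)
  case (Cons p ps)
  define q where "q = free_prefix B p"
  define q' where "q' = free_prefix R p"
  have p: "p \<noteq> []" "hd p = s" using Cons.prems(1) by auto
  have nth: "m < length q \<Longrightarrow> m < length q' \<and> q' ! m = q ! m" for m
    unfolding q_def q'_def using nth_free_prefix_mono Cons.prems(2) by blast
  have hd_q: "s \<in> set q" "q = s # tl q"
    using p by (metis q_def free_prefix_eq_Nil_iff hd_free_prefix list.collapse list.set_intros(1))+
  show ?case
  \<comment> \<open>On the outbound leg along \<open>p\<close>, agreement of \<open>q'\<close> with
    \<open>q\<close> suffices; the shift \<open>Suc n\<close> accounts for the source, which the
    itinerary omits.\<close>
  proof (cases "n < length (tl q)")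
    case True
    then have "Suc n < length q" by auto
    with nth have *: "Suc n < length q'" "q' ! Suc n = q ! Suc n" by auto
    then have "itinerary R (p # ps) ! n = q' ! Suc n"
      by (auto simp: q'_def nth_append nth_tl)
    moreover have "itinerary B (p # ps) ! n = q ! Suc n"
      using True by (auto simp: q_def nth_append nth_tl)
    ultimately show ?thesis using * by simp
  next
    case n: False
    show ?thesis
    proof (cases "q = p")
      case True
      then show ?thesis using n Cons.prems(4) by (simp add: q_def)
    next
      case False
      have it: "itinerary B (p # ps) = tl q @ tl (rev q) @ itinerary B ps"
        using False by (simp add: q_def)
      \<comment> \<open>After the outbound leg all of \<open>q\<close> has been visited, so the
        blocking edge is known and both itineraries turn back at the same vertex.\<close>
      have "set q \<subseteq> set (s # take n (itinerary B (p # ps)))"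
      proof -
        have "set q = insert s (set (tl q))" using hd_q(2) by (metis list.simps(15))
        then show ?thesis using n unfolding it by auto
      qed
      then have "q' = q" unfolding q_def q'_def
        using Cons.prems(2,3) by (intro free_prefix_revealed) blast+
      then have it': "itinerary R (p # ps) = tl q @ tl (rev q) @ itinerary R ps"
        using False by (simp add: q'_def)
      show ?thesis
      proof (cases "n < length (tl q @ tl (rev q))")
        case True
        then show ?thesis
            unfolding it it' by (simp only: append_assoc[symmetric] nth_append if_True)
      next
        case False
        define m where "m = n - length (tl q @ tl (rev q))"
        have m: "n = length (tl q @ tl (rev q)) + m" using False by (simp add: m_def)
        have "itinerary R ps ! m = itinerary B ps ! m"
        proof (rule Cons.IH)
          show "m < length (itinerary B ps)"
            using Cons.prems(4) unfolding it m by simp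
          show "e \<in> R" if "e \<in> B" "e \<inter> set (s # take m (itinerary B ps)) \<noteq> {}" for e
            using Cons.prems(3)[OF that(1)] that(2) unfolding it m by (auto simp: take_append)
        qed (use Cons.prems in auto)
        then show ?thesis
          unfolding it it' m by (simp only: append_assoc[symmetric] nth_append_length_plus)
      qed
    qed
  qed
qed simp

text \<open>A failed attempt costs its free prefix twice, out and back, hence at most twice the
  path. The free path \<open>j\<close> ends the exploration no later than its own turn.\<close>

lemma itinerary_walk:
  assumes "\<And>p. p \<in> set ps \<Longrightarrow> is_path E s t p" and "\<And>e. e \<in> E \<Longrightarrow> 0 \<le> c e"
    and "j \<in> set ps" "free_prefix B j = j"
  shows "is_walk (E - B) (s # itinerary B ps) \<and> last (s # itinerary B ps) = t \<and>
    walk_cost c (s # itinerary B ps) \<le>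
      walk_cost c j + (\<Sum>i\<leftarrow>takeWhile (\<lambda>x. x \<noteq> j) ps. 2 * walk_cost c i)"
  using assms
proof (induction ps)
  case (Cons p ps)
  have nonneg: "0 \<le> walk_cost c i" if "i \<in> set (p # ps)" for i
    using Cons.prems(1)[OF that] Cons.prems(2) walk_cost_nonneg by (auto simp: is_path_def)
  have sum_nonneg: "0 \<le> (\<Sum>i\<leftarrow>takeWhile (\<lambda>x. x \<noteq> j) ps. 2 * walk_cost c i)"
    using nonneg by (intro sum_list_nonneg) (auto dest: set_takeWhileD)
  have p: "is_walk E p" "p \<noteq> []" "hd p = s" "last p = t"
    using Cons.prems(1)[of p] by (auto simp: is_path_def is_walk_def)
  define q where "q = free_prefix B p"
  have q: "is_walk (E - B) q" "q \<noteq> []" "hd q = s" "walk_cost c q \<le> walk_cost c p"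
    using p is_walk_free_prefix walk_cost_free_prefix_le[OF p(1) Cons.prems(2)]
    by (auto simp: q_def)
  show ?case
  proof (cases "q = p")
    \<comment> \<open>The exploration ends with \<open>p\<close>. Either \<open>p\<close> is
      \<open>j\<close>, or it precedes \<open>j\<close> and its single traversal is covered by its
      doubled term in the sum.\<close>
    case True
    then have it: "s # itinerary B (p # ps) = p"
      using p by (auto simp: q_def)
    show ?thesis
      unfolding it using True q p nonneg[of p] nonneg[of j] sum_nonneg Cons.prems(3) by auto
  next
    case False
    \<comment> \<open>\<open>r\<close> is the round trip from the source to the blockage and back;
      each \<open>tl\<close> removes the vertex repeated at a joint.\<close>
    define r where "r = q @ tl (rev q)"
    define z where "z = s # itinerary B ps"
    have it: "s # itinerary B (p # ps) = r @ tl z"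
      using False q(2,3) by (cases q) (auto simp: q_def[symmetric] r_def z_def)
    have j: "j \<noteq> p" "j \<in> set ps" using False Cons.prems(3,4) by (auto simp: q_def)
    have IH: "is_walk (E - B) z" "last z = t" "walk_cost c z \<le>
        walk_cost c j + (\<Sum>i\<leftarrow>takeWhile (\<lambda>x. x \<noteq> j) ps. 2 * walk_cost c i)"
      using Cons.IH[OF Cons.prems(1,2) j(2) Cons.prems(4)] by (auto simp: z_def)
    have last_join: "last (xs @ tl ys) = last ys"
      if "ys \<noteq> []" "xs \<noteq> []" "last xs = hd ys" for xs ys :: "'a list"
      using that by (cases ys) auto
    have r: "is_walk (E - B) r" "r \<noteq> []" "last r = s"
      using q is_walk_append_tl[of "E - B" q "rev q"] last_join[of "rev q" q]
      by (auto simp: r_def is_walk_rev hd_rev last_rev)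
    have "walk_cost c r = 2 * walk_cost c q"
      using q walk_cost_append_tl[of q "rev q" c] by (simp add: r_def hd_rev walk_cost_rev)
    moreover have "walk_cost c (r @ tl z) = walk_cost c r + walk_cost c z"
      using r by (intro walk_cost_append_tl) (auto simp: z_def)
    moreover have "is_walk (E - B) (r @ tl z)"
      using r IH by (intro is_walk_append_tl) (auto simp: z_def)
    moreover have "last (r @ tl z) = t" using last_join[of z r] r IH(2) by (auto simp: z_def)
    ultimately show ?thesis using q(4) IH(3) j(1) unfolding it by simp
  qed
qed simp

text \<open>The past walk enters only through its length, which is the index of the next vertex
  because the source has index 0. The itinerary is recomputed at each move from the blocked edges
  known by then.\<close>

definition explore :: "'v \<Rightarrow> 'v list list \<Rightarrow> 'v strategy" where
  "explore s ps w R = (s # itinerary R ps) ! length w"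

lemma run_explore:
  assumes "\<And>p. p \<in> set ps \<Longrightarrow> p \<noteq> [] \<and> hd p = source I"
    and "n \<le> length (itinerary B ps)"
  shows "run I B (explore (source I) ps) n = take (Suc n) (source I # itinerary B ps)"
  using assms(2)
proof (induction n)
  case (Suc n)
  let ?w = "take (Suc n) (source I # itinerary B ps)"
  have "itinerary (revealed B ?w) ps ! n = itinerary B ps ! n"
    using assms(1) Suc.prems
    by (intro itinerary_revealed[where s = "source I"]) (auto simp: revealed_def)
  then have "explore (source I) ps ?w (revealed B ?w) = itinerary B ps ! n"
    using Suc.prems by (simp add: explore_def)
  then show ?case using Suc by (simp add: take_Suc_conv_app_nth)
qed simp

lemma travel_cost_explore_le:
  assumes paths: "\<And>p. p \<in> set ps \<Longrightarrow> is_path (edges I) (source I) (target I) p"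
    and nonneg: "\<And>e. e \<in> edges I \<Longrightarrow> 0 \<le> cost I e"
    and j: "j \<in> set ps" "free_prefix B j = j"
  shows "travel_cost I B (explore (source I) ps) \<le> ennreal (walk_cost (cost I) j +
    (\<Sum>i\<leftarrow>takeWhile (\<lambda>x. x \<noteq> j) ps. 2 * walk_cost (cost I) i))"
proof -
  let ?\<sigma> = "explore (source I) ps" and ?w = "source I # itinerary B ps"
  define N where "N = length (itinerary B ps)"
  have run: "run I B ?\<sigma> n = take (Suc n) ?w" if "n \<le> N" for n
    using run_explore[of ps I n B] paths that by (auto simp: N_def is_path_def is_walk_def)
  have walk: "is_walk (edges I - B) ?w" "last ?w = target I"
    "walk_cost (cost I) ?w \<le> walk_cost (cost I) j +
      (\<Sum>i\<leftarrow>takeWhile (\<lambda>x. x \<noteq> j) ps. 2 * walk_cost (cost I) i)"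
    using itinerary_walk[where E = "edges I" and c = "cost I", OF paths nonneg j] by blast+
  have arrived: "arrived I B ?\<sigma> N"
    using walk run[of N] by (simp add: arrived_def N_def)
  define n where "n = (LEAST n. arrived I B ?\<sigma> n)"
  have "n \<le> N" unfolding n_def using arrived by (rule Least_le)
  then have "walk_cost (cost I) (run I B ?\<sigma> n) \<le> walk_cost (cost I) ?w"
    using run walk_cost_take_le[OF walk(1), of "cost I"] nonneg by (simp del: take_Suc_Cons)
  then show ?thesis
    using arrived walk(3) unfolding travel_cost_def n_def[symmetric]
    by (auto intro!: ennreal_leI)
qed

section \<open>Counting blocked paths\<close>

text \<open>Handles the only edge that two distinct paths of a path-disjoint graph could share, the
  one joining source and target: it already is the whole path.\<close>

lemma distinct_path_source_target_adjacent:
  assumes "distinct p" "p = xs @ [u, v] @ ys" "{u, v} = {hd p, last p}"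
  shows "p = [hd p, last p]"
proof -
  have "hd p \<noteq> v"
    using assms(1,2) by (cases xs) auto
  then have ends: "hd p = u" "last p = v"
    using assms(3) by (auto simp: doubleton_eq_iff)
  have "xs = []"
    using ends(1) assms(1,2) by (cases xs) auto
  moreover have "ys = []"
    using ends(2) assms(1,2) by (cases ys rule: rev_cases) auto
  ultimately show ?thesis using assms(2) by simp
qed

lemma not_free_prefixE:
  assumes "free_prefix B p \<noteq> p"
  obtains xs u v ys where "p = xs @ [u, v] @ ys" "{u, v} \<in> B"
proof -
  have "\<exists>xs u v ys. p = xs @ [u, v] @ ys \<and> {u, v} \<in> B"
    using assms
  proof (induction B p rule: free_prefix.induct)
    case (1 B u v p)
    show ?case
    proof (cases "{u, v} \<in> B")
      case True
      then show ?thesis by (metis append_Cons append_Nil)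
    next
      case False
      then obtain xs x y ys where "v # p = xs @ [x, y] @ ys" "{x, y} \<in> B" using 1 by auto
      then show ?thesis by (metis append_Cons)
    qed
  qed auto
  then show ?thesis using that by blast
qed

text \<open>Choosing a blocked edge on each blocked path is injective: distinct paths with a common
  edge would share only source and target, so both would consist of that edge alone.\<close>

lemma card_blocked_paths_le:
  assumes "path_disjoint I" "finite B" and P: "P = {p. is_path (edges I) (source I) (target I) p}"
  shows "card {p \<in> P. free_prefix B p \<noteq> p} \<le> card B"
proof -
  have "\<forall>p\<in>{p \<in> P. free_prefix B p \<noteq> p}.
      \<exists>e. e \<in> B \<and> (\<exists>xs u v ys. e = {u, v} \<and> p = xs @ [u, v] @ ys)"
    by (blast elim: not_free_prefixE)
  from bchoice[OF this] obtain h where h: "\<forall>p\<in>{p \<in> P. free_prefix B p \<noteq> p}.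
      h p \<in> B \<and> (\<exists>xs u v ys. h p = {u, v} \<and> p = xs @ [u, v] @ ys)"
    by (elim exE) (rule that)
  have "inj_on h {p \<in> P. free_prefix B p \<noteq> p}"
  proof (rule inj_onI, rule ccontr)
    fix p q
    assume p: "p \<in> {p \<in> P. free_prefix B p \<noteq> p}" and q: "q \<in> {p \<in> P. free_prefix B p \<noteq> p}"
      and eq: "h p = h q" and "p \<noteq> q"
    then have ends: "hd p = source I" "last p = target I" "hd q = source I" "last q = target I"
      "distinct p" "distinct q"
      by (auto simp: P is_path_def)
    obtain xs u v ys where 1: "h p = {u, v}" "p = xs @ [u, v] @ ys" using h p by blast
    obtain xs' u' v' ys' where 2: "h q = {u', v'}" "q = xs' @ [u', v'] @ ys'" using h q by blast
    have "h p \<subseteq> set p \<inter> set q" using 1 2 eq by auto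
    also have "\<dots> \<subseteq> {source I, target I}"
      using assms(1) p q \<open>p \<noteq> q\<close> by (auto simp: path_disjoint_def P)
    \<comment> \<open>Distinctness of \<open>p\<close> gives two different endpoints, which turns
      the inclusion into an equality.\<close>
    finally have "{u, v} = {source I, target I}" "{u', v'} = {source I, target I}"
      using 1 2 eq ends(5) by auto
    then have "p = [source I, target I]" "q = [source I, target I]"
      using distinct_path_source_target_adjacent[OF _ 1(2)]
        distinct_path_source_target_adjacent[OF _ 2(2)] ends by auto
    then show False using \<open>p \<noteq> q\<close> by simp
  qed
  moreover have "h ` {p \<in> P. free_prefix B p \<noteq> p} \<subseteq> B" using h by blast
  ultimately show ?thesis using assms(2) by (intro card_inj_on_le)
qed

text \<open>Costliest elements are deleted one by one until at most \<open>k + 1\<close> remain. For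
  paths, \<open>U\<close> is the set of unblocked ones, which misses at most
  \<open>k\<close>.\<close>

lemma ex_cheapest_subset:
  fixes d :: "'a \<Rightarrow> real"
  assumes "finite P"
  shows "\<exists>S\<subseteq>P. card S \<le> Suc k \<and> (\<forall>U\<subseteq>P. U \<noteq> {} \<longrightarrow> card (P - U) \<le> k \<longrightarrow>
    (\<exists>j\<in>S \<inter> U. \<forall>u\<in>U. d j \<le> d u))"
  using assms
proof (induction P rule: finite_psubset_induct)
  case (psubset P)
  show ?case
  proof (cases "card P \<le> Suc k")
    case True
    have "\<exists>j\<in>P \<inter> U. \<forall>u\<in>U. d j \<le> d u" if "U \<subseteq> P" "U \<noteq> {}" for U
      using that ex_is_arg_min_if_finite[of U d] psubset.hyps
      by (metis finite_subset inf.absorb_iff2 is_arg_min_linorder)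
    then show ?thesis using True by blast
  next
    case False
    then have "P \<noteq> {}" by auto
    then obtain m where m: "m \<in> P" "\<And>x. x \<in> P \<Longrightarrow> d x \<le> d m"
      using Max_in[of "d ` P"] Max_ge[of "d ` P"] psubset.hyps by fastforce
    obtain S where S: "S \<subseteq> P - {m}" "card S \<le> Suc k"
      "\<And>U. U \<subseteq> P - {m} \<Longrightarrow> U \<noteq> {} \<Longrightarrow> card (P - {m} - U) \<le> k \<Longrightarrow>
        \<exists>j\<in>S \<inter> U. \<forall>u\<in>U. d j \<le> d u"
      using psubset.IH[of "P - {m}"] m(1) by blast
    have "\<exists>j\<in>S \<inter> U. \<forall>u\<in>U. d j \<le> d u" if U: "U \<subseteq> P" "card (P - U) \<le> k" for U
    proof -
      have "P - {m} - (U - {m}) \<subseteq> P - U" by blast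
      then have card: "card (P - {m} - (U - {m})) \<le> k"
        using U(2) psubset.hyps by (meson card_mono finite_Diff order_trans)
      \<comment> \<open>More than \<open>k\<close> elements survive the deletion and at most
        \<open>k\<close> of them lie outside \<open>U\<close>, so \<open>U\<close> has an element
        besides \<open>m\<close>. A minimiser over \<open>U - {m}\<close> also beats
        \<open>m\<close>, which is costliest.\<close>
      moreover have "card (P - {m}) > k" using False m(1) psubset.hyps by simp
      ultimately have "U - {m} \<noteq> {}" by (metis Diff_empty not_less)
      then obtain j where "j \<in> S \<inter> (U - {m})" "\<forall>u\<in>U - {m}. d j \<le> d u"
        using S(3)[of "U - {m}"] U(1) card by blast
      then show ?thesis using m(2)[of j] U(1) by (intro bexI[of _ j]) auto
    qed
    then show ?thesis using S(1,2) by blast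
  qed
qed

lemma finite_paths:
  assumes "ctp_input I"
  shows "finite {p. is_path (edges I) (source I) (target I) p}"
proof -
  have sub: "set p \<subseteq> verts I" if "is_walk (edges I) p" "hd p \<in> verts I" for p
    using that
  proof (induction p rule: induct_list012)
    case (3 x y zs)
    then show ?case using assms by (fastforce simp: is_walk_def ctp_input_def)
  qed auto
  have "{p. is_path (edges I) (source I) (target I) p} \<subseteq> {p. set p \<subseteq> verts I \<and> distinct p}"
    using assms sub by (intro Collect_mono) (simp add: is_path_def ctp_input_def)
  then show ?thesis
    using assms finite_subset finite_subset_distinct by (fastforce simp: ctp_input_def)
qed

section \<open>The randomized algorithm\<close>

text \<open>Linearity of expectation: rewritten with indicators over the fixed set
  \<open>S - {j}\<close>, the bound for a single order integrates term by term to precedence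
  probabilities.\<close>

lemma expected_cost_explore_le:
  fixes Q :: "'v list list pmf"
  assumes Q: "\<forall>\<pi>\<in>set_pmf Q. distinct \<pi> \<and> set \<pi> = S"
    and "finite S"
    and paths: "\<And>p. p \<in> S \<Longrightarrow> is_path (edges I) (source I) (target I) p"
    and nonneg: "\<And>e. e \<in> edges I \<Longrightarrow> 0 \<le> cost I e"
    and j: "j \<in> S" "free_prefix B j = j"
  shows "(\<integral>\<^sup>+ \<sigma>. travel_cost I B \<sigma> \<partial>measure_pmf (map_pmf (explore (source I)) Q)) \<le>
    ennreal (walk_cost (cost I) j + (\<Sum>i\<in>S - {j}. 2 * walk_cost (cost I) i *
      measure_pmf.prob Q {\<pi>. i \<in> set (takeWhile (\<lambda>x. x \<noteq> j) \<pi>)}))"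
proof -
  define d where "d = walk_cost (cost I)"
  define before where "before i = {\<pi>. i \<in> set (takeWhile (\<lambda>x. x \<noteq> j) \<pi>)}" for i
  define g where "g \<pi> = d j + (\<Sum>i\<in>S - {j}. 2 * d i * indicator (before i) \<pi>)" for \<pi>
  have d: "0 \<le> d p" if "p \<in> S" for p
    using paths[OF that] nonneg walk_cost_nonneg by (auto simp: is_path_def d_def)
  have g: "travel_cost I B (explore (source I) \<pi>) \<le> ennreal (g \<pi>)" if "\<pi> \<in> set_pmf Q" for \<pi>
  proof -
    have \<pi>: "distinct \<pi>" "set \<pi> = S" using Q that by auto
    have "(\<Sum>i\<leftarrow>takeWhile (\<lambda>x. x \<noteq> j) \<pi>. 2 * d i) =
        (\<Sum>i\<in>set (takeWhile (\<lambda>x. x \<noteq> j) \<pi>). 2 * d i)"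
      using \<pi> by (simp add: sum_list_distinct_conv_sum_set)
    also have "\<dots> = (\<Sum>i\<in>S - {j}. 2 * d i * indicator (before i) \<pi>)"
      using \<pi> \<open>finite S\<close>
      by (intro sum.mono_neutral_cong_left) (auto simp: before_def dest: set_takeWhileD)
    finally show ?thesis
      using travel_cost_explore_le[of \<pi> I j B] paths nonneg j \<pi> by (simp add: g_def d_def)
  qed
  have "(\<integral>\<^sup>+ \<sigma>. travel_cost I B \<sigma> \<partial>measure_pmf (map_pmf (explore (source I)) Q)) \<le>
      (\<integral>\<^sup>+ \<pi>. ennreal (g \<pi>) \<partial>measure_pmf Q)"
    unfolding nn_integral_map_pmf using g by (intro nn_integral_mono_AE) (simp add: AE_measure_pmf_iff)
  also have "\<dots> = ennreal (\<integral>\<pi>. g \<pi> \<partial>measure_pmf Q)"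
    using d j unfolding g_def
    by (intro nn_integral_eq_integral AE_I2 add_nonneg_nonneg sum_nonneg) (auto simp: measure_pmf.emeasure_eq_measure)
  also have "(\<integral>\<pi>. g \<pi> \<partial>measure_pmf Q) = d j + (\<Sum>i\<in>S - {j}. 2 * d i * measure_pmf.prob Q (before i))"
    unfolding g_def by (simp add: measure_pmf.emeasure_eq_measure)
  finally show ?thesis by (simp add: d_def before_def)
qed

theorem theorem4:
  fixes k :: nat and \<epsilon> :: real
  assumes "k \<ge> 1" and "0 < \<epsilon>" and "\<epsilon> \<le> real k"
  shows "\<exists>A :: 'v online_algorithm.
           competitive_on path_disjoint k A (1 + \<epsilon>) (real k + 4 * real k / \<epsilon>)"
proof -
  \<comment> \<open>The distribution \<open>q\<close> is fixed before \<open>B\<close> is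
    quantified, so it depends on the advance information only; choice over \<open>I\<close> then
    yields the algorithm.\<close>
  have "\<exists>q :: 'v strategy pmf. \<forall>B. blockage I B \<longrightarrow>
      (B = predicted I \<longrightarrow> (\<integral>\<^sup>+ \<sigma>. travel_cost I B \<sigma> \<partial>measure_pmf q) \<le> ennreal ((1 + \<epsilon>) * opt I B)) \<and>
      (B \<noteq> predicted I \<longrightarrow> (\<integral>\<^sup>+ \<sigma>. travel_cost I B \<sigma> \<partial>measure_pmf q) \<le>
        ennreal ((real k + 4 * real k / \<epsilon>) * opt I B))"
    if I: "ctp_input I" "budget I = k" "path_disjoint I" for I :: "'v ctp_input"
  proof -
    define P where "P = {p. is_path (edges I) (source I) (target I) p}"
    define d where "d = walk_cost (cost I)"
    define free where "free B = {p \<in> P. free_prefix B p = p}" for B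
    have P: "finite P" "P \<noteq> {}"
      using finite_paths[OF I(1)] I(1) by (auto simp: P_def ctp_input_def)
    have nonneg: "0 \<le> cost I e" if "e \<in> edges I" for e
      using I(1) that by (auto simp: ctp_input_def)
    have d: "0 \<le> d p" if "p \<in> P" for p
      using that nonneg walk_cost_nonneg by (auto simp: P_def is_path_def d_def)
    obtain S where S: "S \<subseteq> P" "card S \<le> Suc k"
      "\<And>U. U \<subseteq> P \<Longrightarrow> U \<noteq> {} \<Longrightarrow> card (P - U) \<le> k \<Longrightarrow> \<exists>j\<in>S \<inter> U. \<forall>u\<in>U. d j \<le> d u"
      using ex_cheapest_subset[OF P(1), of k d] by blast
    have fin_S: "finite S" using S(1) P(1) by (rule finite_subset)
    \<comment> \<open>At most \<open>k\<close> paths are blocked, so \<open>S\<close> retains a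
      cheapest free path whatever the blockage.\<close>
    have best: "\<exists>j\<in>S. free_prefix B j = j \<and> opt I B = d j" if B: "blockage I B" for B
    proof -
      have "finite (edges I)" using I(1) finite_subset[of "edges I" "Pow (verts I)"]
        by (auto simp: ctp_input_def)
      then have fin_B: "finite B" using B finite_subset by (auto simp: blockage_def)
      have eq: "{p. is_path (edges I - B) (source I) (target I) p} = free B"
        by (auto simp: is_path_diff_iff free_def P_def)
      have "P - free B = {p \<in> P. free_prefix B p \<noteq> p}" by (auto simp: free_def)
      then have "card (P - free B) \<le> k"
        using card_blocked_paths_le[OF I(3) fin_B P_def] B I(2) by (simp add: blockage_def)
      moreover have "free B \<noteq> {}" using B eq by (auto simp: blockage_def)
      ultimately obtain j where j: "j \<in> S \<inter> free B" "\<forall>u\<in>free B. d j \<le> d u"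
        using S(3)[of "free B"] by (auto simp: free_def)
      have "opt I B = d j"
        unfolding opt_def eq d_def[symmetric]
        using j P(1) by (intro Min_eqI) (auto simp: free_def)
      then show ?thesis using j(1) by (auto simp: free_def)
    qed
    \<comment> \<open>If the predicted blockage disconnects source and target, any path may serve as \<open>star\<close>.\<close>
    obtain star where star: "star \<in> S"
      "blockage I (predicted I) \<Longrightarrow>
        free_prefix (predicted I) star = star \<and> opt I (predicted I) = d star"
      using best[of "predicted I"] S(3)[of P] P by (cases "blockage I (predicted I)") auto
    define e where "e p = (if p = star then \<epsilon> / (2 * real k) * d star else d p)" for p
    have e: "\<forall>p\<in>S. 0 \<le> e p"
      using S(1) d assms by (auto simp: e_def)
    define before where "before i j = {\<pi>. i \<in> set (takeWhile (\<lambda>x. x \<noteq> j) \<pi>)}" for i j :: "'v list"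
    obtain Q where Q: "\<forall>\<pi>\<in>set_pmf Q. distinct \<pi> \<and> set \<pi> = S"
      "\<forall>i\<in>S. \<forall>j\<in>S. i \<noteq> j \<longrightarrow> 2 * e i * measure_pmf.prob Q (before i j) \<le> e j"
      using ex_balanced_random_order[OF fin_S e, folded before_def] by (elim exE conjE) (rule that)
    define E where "E B = (\<integral>\<^sup>+ \<sigma>. travel_cost I B \<sigma> \<partial>map_pmf (explore (source I)) Q)" for B
    define bound where
      "bound j = d j + (\<Sum>i\<in>S - {j}. 2 * d i * measure_pmf.prob Q (before i j))" for j
    have E: "E B \<le> ennreal (bound j)" if "j \<in> S" "free_prefix B j = j" for j B
      unfolding E_def bound_def before_def d_def
      using expected_cost_explore_le[OF Q(1) fin_S _ nonneg that] S(1) by (auto simp: P_def)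
    have odds: "2 * d i * measure_pmf.prob Q (before i j) \<le> e j"
      if "i \<in> S" "j \<in> S" "i \<noteq> j" "i \<noteq> star" for i j
      using bspec[OF bspec[OF Q(2) that(1)] that(2)] that(3,4) by (simp add: e_def)
    \<comment> \<open>The terms in \<open>\<epsilon>\<close> obtained here and in
      \<open>bound_other\<close> are half of those claimed.\<close>
    have bound_star: "bound star \<le> (1 + \<epsilon> / 2) * d star"
    proof -
      have "(\<Sum>i\<in>S - {star}. 2 * d i * measure_pmf.prob Q (before i star)) \<le>
          real (card (S - {star})) * e star"
        using odds star(1) by (intro sum_bounded_above) auto
      also have "\<dots> \<le> real k * e star"
        using S(2) star(1) fin_S e by (intro mult_right_mono) auto
      also have "\<dots> = \<epsilon> / 2 * d star" using assms by (simp add: e_def)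
      finally show ?thesis by (simp add: bound_def algebra_simps)
    qed
    have bound_other: "bound j \<le> (real k + 2 * real k / \<epsilon>) * d j" if j: "j \<in> S" "j \<noteq> star" for j
    proof -
      have "2 * e star * measure_pmf.prob Q (before star j) \<le> d j"
        using bspec[OF bspec[OF Q(2) star(1)] j(1)] j(2) by (simp add: e_def)
      then have "2 * d star * measure_pmf.prob Q (before star j) \<le> 2 * real k / \<epsilon> * d j"
        using assms by (simp add: e_def field_simps)
      moreover have "(\<Sum>i\<in>S - {j} - {star}. 2 * d i * measure_pmf.prob Q (before i j)) \<le>
          real (card (S - {j} - {star})) * d j"
        using odds[of _ j] j by (intro sum_bounded_above) (auto simp: e_def)
      \<comment> \<open>At most \<open>k - 1\<close> paths of \<open>S\<close> differ from both
        \<open>j\<close> and \<open>star\<close>; their share and the final traversal of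
        \<open>j\<close> add up to \<open>k * d j\<close>.\<close>
      moreover have "real (card (S - {j} - {star})) * d j \<le> (real k - 1) * d j"
        using S(2) j star(1) fin_S d S(1) assms(1) by (intro mult_right_mono) (auto simp: card_Diff_singleton)
      moreover have "(\<Sum>i\<in>S - {j}. 2 * d i * measure_pmf.prob Q (before i j)) =
          2 * d star * measure_pmf.prob Q (before star j) +
          (\<Sum>i\<in>S - {j} - {star}. 2 * d i * measure_pmf.prob Q (before i j))"
        using fin_S star(1) j by (intro sum.remove) auto
      ultimately show ?thesis unfolding bound_def by (simp add: algebra_simps)
    qed
    \<comment> \<open>Even under a wrong prediction \<open>star\<close> may be the optimal path, so
      \<open>bound_star\<close> must fit below the second ratio too;
      \<open>\<epsilon> \<le> real k\<close> ensures this.\<close>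
    have ratio: "4 \<le> 4 * real k / \<epsilon>" using assms by (simp add: field_simps)
    have "E B \<le> ennreal ((1 + \<epsilon>) * opt I B)" if B: "blockage I B" "B = predicted I" for B
    proof -
      have "bound star \<le> (1 + \<epsilon>) * d star"
        using assms d[of star] star(1) S(1)
        by (intro order_trans[OF bound_star] mult_right_mono) auto
      then show ?thesis
        using E[of star B] star B by (auto intro: order_trans ennreal_leI)
    qed
    moreover have "E B \<le> ennreal ((real k + 4 * real k / \<epsilon>) * opt I B)" if B: "blockage I B" for B
    proof -
      obtain j where j: "j \<in> S" "free_prefix B j = j" "opt I B = d j" using best[OF B] by blast
      have dj: "0 \<le> d j" using j(1) S(1) d by auto
      have "bound j \<le> (real k + 4 * real k / \<epsilon>) * d j"
      proof (cases "j = star")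
        case True
        have "1 + \<epsilon> / 2 \<le> real k + 4 * real k / \<epsilon>" using ratio assms by linarith
        then show ?thesis using True bound_star dj by (meson mult_right_mono order_trans)
      next
        case False
        have "real k + 2 * real k / \<epsilon> \<le> real k + 4 * real k / \<epsilon>"
          using assms by (simp add: divide_right_mono)
        then show ?thesis using False bound_other j(1) dj by (meson mult_right_mono order_trans)
      qed
      then show ?thesis using E[OF j(1,2)] j(3) by (auto intro: order_trans ennreal_leI)
    qed
    ultimately show ?thesis unfolding E_def by blast
  qed
  then obtain A :: "'v online_algorithm" where
    "\<And>I B. ctp_input I \<Longrightarrow> budget I = k \<Longrightarrow> path_disjoint I \<Longrightarrow> blockage I B \<Longrightarrow>
      (B = predicted I \<longrightarrow> expected_cost A I B \<le> ennreal ((1 + \<epsilon>) * opt I B)) \<and>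
      (B \<noteq> predicted I \<longrightarrow> expected_cost A I B \<le> ennreal ((real k + 4 * real k / \<epsilon>) * opt I B))"
    unfolding expected_cost_def by metis
  then show ?thesis unfolding competitive_on_def by blast
qed

end
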